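(* The discoloration operator $D_{\mathcal M}\colon\mathcal M\to\mathcal A$, defined on a framed chord diagram $d$ by $D_{\mathcal M}(d)=(-1)^{w}d'$ and extended by linearity, where $w$ is the number of disorienting chords of $d$ and $d'$ is obtained from $d$ by setting the framings of all the chords to be $0$, is well-defined.
   Context: $\mathbb K$ is a field of characteristic $0$. Chord diagrams. For $n\ge 0$, an order $n$ chord diagram is a collection of $n$ chords, i.e. $n$ pairs of points on an oriented circle (all $2n$ points pairwise distinct), considered up to orientation preserving diffeomorphisms of the circle. An order $n$ framed chord diagram is a chord diagram together with a framing, i.e. a map from the set of chords to $\mathbb Z/2\mathbb Z$; chords of framing $0$ are called oriented, chords of framing $1$ are called disorienting. Ordinary chord diagrams are identified with framed ones all of whose chords are oriented. Framed 4T-relations. Take any collection of framed chords on the oriented circle, containing a distinguished chord $v$ with endpoints $p,q$, and a further point $r$ on the circle distinct from all endpoints. Let $p^-,p^+$ (resp. $q^-,q^+$) be points immediately before and immediately after $p$ (resp. $q$) with respect to the orientation, with no other chord endpoint and not $r$ in between. For $x\in\{p^\pm,q^\pm\}$ and $\varphi\in\mathbb Z/2\mathbb Z$ let $D^{\varphi}(x)$ be the framed chord diagram obtained by adding one more chord $u$ (the jumping chord) with endpoints $r$ and $x$ and framing $\varphi$. The relations are, for each $\varphi$: if $v$ is oriented, $D^{\varphi}(p^-)-D^{\varphi}(p^+)=D^{\varphi}(q^+)-D^{\varphi}(q^-)$; if $v$ is disorienting, $D^{\varphi}(p^-)-D^{\varphi}(p^+)=D^{\varphi+1}(q^-)-D^{\varphi+1}(q^+)$.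 $\mathcal M$ is the $\mathbb K$-vector space spanned by all framed chord diagrams modulo all framed 4T-relations. $\mathcal A$ is the $\mathbb K$-vector space spanned by ordinary chord diagrams modulo the ordinary 4T-relations, i.e. the relations $D^{0}(p^-)-D^{0}(p^+)=D^{0}(q^+)-D^{0}(q^-)$ for collections of chords all of which (including $v$) are oriented. *)

theory Defs
  imports "HOL-Analysis.Analysis" "HOL-Library.Poly_Mapping" "HOL-Library.Z2"
begin

section \<open>Orientation preserving diffeomorphisms of the circle\<close>

abbreviation circle :: "complex set" where
  "circle \<equiv> sphere 0 1"

definition smooth_curve :: "(real \<Rightarrow> complex) \<Rightarrow> bool" where
  "smooth_curve \<gamma> \<longleftrightarrow>
    (\<forall>n t. ((\<lambda>h s. vector_derivative h (at s)) ^^ n) \<gamma> differentiable at t)"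

text \<open>
  The circle carries the counterclockwise orientation, so \<open>\<i> * z\<close> is the positive unit tangent
  vector at \<open>z\<close>, and \<^const>\<open>cis\<close> is an orientation preserving local diffeomorphism onto the
  circle.  Hence a self-map \<open>f\<close> of the circle is smooth iff \<open>\<lambda>t. f (cis t)\<close> is.  Values of \<open>f\<close>
  off the circle are irrelevant.
\<close>

definition orientation_preserving_diffeo :: "(complex \<Rightarrow> complex) \<Rightarrow> bool" where
  "orientation_preserving_diffeo f \<longleftrightarrow>
    bij_betw f circle circle \<and>
    smooth_curve (\<lambda>t. f (cis t)) \<and>
    smooth_curve (\<lambda>t. inv_into circle f (cis t)) \<and>
    (\<forall>t. \<exists>a>0. ((\<lambda>s. f (cis s)) has_vector_derivative a *\<^sub>R (\<i> * f (cis t))) (at t))"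

subsection \<open>They form a group\<close>

definition smooth_upto :: "nat \<Rightarrow> (real \<Rightarrow> complex) \<Rightarrow> bool" where
  "smooth_upto n \<gamma> \<longleftrightarrow>
    (\<forall>k<n. \<forall>t. ((\<lambda>h s. vector_derivative h (at s)) ^^ k) \<gamma> differentiable at t)"

lemma smooth_curve_iff_upto: "smooth_curve \<gamma> \<longleftrightarrow> (\<forall>n. smooth_upto n \<gamma>)"
  unfolding smooth_curve_def smooth_upto_def by blast

lemma smooth_upto_0 [simp]: "smooth_upto 0 \<gamma>"
  by (simp add: smooth_upto_def)

lemma smooth_upto_Suc_vector_derivative:
  "smooth_upto (Suc n) \<gamma> \<longleftrightarrow>
    (\<forall>t. \<gamma> differentiable at t) \<and> smooth_upto n (\<lambda>t. vector_derivative \<gamma> (at t))"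
proof -
  let ?P = "\<lambda>k. \<forall>t. ((\<lambda>h s. vector_derivative h (at s)) ^^ k) \<gamma> differentiable at t"
  have "(\<forall>k<Suc n. ?P k) \<longleftrightarrow> ?P 0 \<and> (\<forall>k<n. ?P (Suc k))"
    using less_Suc_eq_0_disj by auto
  then show ?thesis
    unfolding smooth_upto_def by (simp add: funpow_Suc_right del: funpow.simps(2))
qed

lemma smooth_upto_Suc:
  "smooth_upto (Suc n) \<gamma> \<longleftrightarrow>
    (\<exists>\<gamma>'. (\<forall>t. (\<gamma> has_vector_derivative \<gamma>' t) (at t)) \<and> smooth_upto n \<gamma>')" (is "?l \<longleftrightarrow> ?r")
proof
  assume ?l
  then show ?r
    unfolding smooth_upto_Suc_vector_derivative vector_derivative_works
    by (intro exI[of _ "\<lambda>t. vector_derivative \<gamma> (at t)"]) simp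
next
  assume ?r
  then obtain \<gamma>' where g: "\<forall>t. (\<gamma> has_vector_derivative \<gamma>' t) (at t)" "smooth_upto n \<gamma>'"
    by blast
  then have "(\<lambda>t. vector_derivative \<gamma> (at t)) = \<gamma>'"
    using vector_derivative_at by blast
  with g show ?l using smooth_upto_Suc_vector_derivative differentiableI_vector by metis
qed

lemma smooth_upto_SucD: "smooth_upto (Suc n) \<gamma> \<Longrightarrow> smooth_upto n \<gamma>"
  by (simp add: smooth_upto_def)

lemma smooth_upto_add:
  "smooth_upto n f \<Longrightarrow> smooth_upto n g \<Longrightarrow> smooth_upto n (\<lambda>t. f t + g t)"
proof (induction n arbitrary: f g)
  case (Suc n)
  obtain f' g' where
    "\<forall>t. (f has_vector_derivative f' t) (at t)" "smooth_upto n f'"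
    "\<forall>t. (g has_vector_derivative g' t) (at t)" "smooth_upto n g'"
    using Suc.prems smooth_upto_Suc by metis
  then show ?case
    unfolding smooth_upto_Suc
    by (intro exI[of _ "\<lambda>t. f' t + g' t"]) (auto intro: has_vector_derivative_add Suc.IH)
qed simp

lemma smooth_upto_mult:
  "smooth_upto n f \<Longrightarrow> smooth_upto n g \<Longrightarrow> smooth_upto n (\<lambda>t. f t * g t)"
proof (induction n arbitrary: f g)
  case (Suc n)
  obtain f' g' where
    "\<forall>t. (f has_vector_derivative f' t) (at t)" "smooth_upto n f'"
    "\<forall>t. (g has_vector_derivative g' t) (at t)" "smooth_upto n g'"
    using Suc.prems smooth_upto_Suc by metis
  then show ?case
    unfolding smooth_upto_Suc using Suc.prems
    by (intro exI[of _ "\<lambda>t. f t * g' t + f' t * g t"])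
      (auto intro!: has_vector_derivative_mult Suc.IH smooth_upto_add dest: smooth_upto_SucD)
qed simp

lemma smooth_upto_linear:
  assumes "bounded_linear L"
  shows "smooth_upto n f \<Longrightarrow> smooth_upto n (\<lambda>t. L (f t))"
proof (induction n arbitrary: f)
  case (Suc n)
  obtain f' where "\<forall>t. (f has_vector_derivative f' t) (at t)" "smooth_upto n f'"
    using Suc.prems smooth_upto_Suc by metis
  then show ?case
    unfolding smooth_upto_Suc
    by (intro exI[of _ "\<lambda>t. L (f' t)"])
      (auto intro: bounded_linear.has_vector_derivative[OF assms] Suc.IH)
qed simp

lemma has_vector_derivative_cis: "(cis has_vector_derivative \<i> * cis t) (at t)"
  unfolding has_vector_derivative_def
  by (rule has_derivative_eq_rhs, rule has_derivative_cis, rule has_derivative_ident)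
    (simp add: fun_eq_iff)

lemma smooth_curve_cis: "smooth_curve cis"
proof -
  have "smooth_upto n (\<lambda>t. c * cis t)" for n c
  proof (induction n arbitrary: c)
    case (Suc n)
    have "((\<lambda>t. c * cis t) has_vector_derivative c * \<i> * cis t) (at t)" for t
      using has_vector_derivative_mult_right[OF has_vector_derivative_cis, of c t]
      by (simp add: mult.assoc)
    then show ?case unfolding smooth_upto_Suc using Suc.IH
      by (intro exI[of _ "\<lambda>t. c * \<i> * cis t"]) simp
  qed simp
  from this[of _ 1] show ?thesis by (simp add: smooth_curve_iff_upto)
qed

lemma cis_Arg_unit: "norm z = 1 \<Longrightarrow> cis (Arg z) = z"
  using cis_Arg[of z] by (cases "z = 0") (auto simp: sgn_eq)

lemma unit_curve_tangent:
  assumes "\<And>t. norm (\<gamma> t) = 1" and "(\<gamma> has_vector_derivative v) (at t)"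
  shows "v = Im (v * cnj (\<gamma> t)) *\<^sub>R (\<i> * \<gamma> t)"
proof -
  have "((\<lambda>t. \<gamma> t * cnj (\<gamma> t)) has_vector_derivative \<gamma> t * cnj v + v * cnj (\<gamma> t)) (at t)"
    by (intro has_vector_derivative_mult assms
        bounded_linear.has_vector_derivative[OF bounded_linear_cnj])
  moreover have "(\<lambda>t. \<gamma> t * cnj (\<gamma> t)) = (\<lambda>t. 1)"
    using assms(1) by (simp add: complex_norm_square[symmetric])
  ultimately have "\<gamma> t * cnj v + v * cnj (\<gamma> t) = 0"
    using vector_derivative_unique_at has_vector_derivative_const by metis
  then have "Re (\<gamma> t * cnj v + v * cnj (\<gamma> t)) = 0" by (metis zero_complex.sel(1))
  then have "Re (v * cnj (\<gamma> t)) = 0"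
    by (simp add: algebra_simps)
  then have "v * cnj (\<gamma> t) = \<i> * Im (v * cnj (\<gamma> t))"
    by (simp add: complex_eq_iff)
  then have "v * (cnj (\<gamma> t) * \<gamma> t) = \<i> * Im (v * cnj (\<gamma> t)) * \<gamma> t"
    by (metis mult.assoc)
  moreover have "cnj (\<gamma> t) * \<gamma> t = 1"
    using assms(1)[of t] by (simp add: mult.commute complex_norm_square[symmetric])
  ultimately show ?thesis
    by (simp add: scaleR_conv_of_real algebra_simps)
qed

lemma circle_chain_rule:
  assumes \<gamma>: "\<And>t. norm (\<gamma> t) = 1" "(\<gamma> has_vector_derivative b *\<^sub>R (\<i> * \<gamma> t)) (at t)"
    and f: "((\<lambda>s. f (cis s)) has_vector_derivative w) (at u)" "cis u = \<gamma> t"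
  shows "((\<lambda>t. f (\<gamma> t)) has_vector_derivative b *\<^sub>R w) (at t)"
proof -
  define \<theta> where "\<theta> s = u + Im (Ln (\<gamma> s / \<gamma> t))" for s
  have nz: "\<gamma> s \<noteq> 0" for s using \<gamma>(1)[of s] by auto
  have cis\<theta>: "cis (\<theta> s) = \<gamma> s" for s
  proof -
    have "cis (Im (Ln (\<gamma> s / \<gamma> t))) = \<gamma> s / \<gamma> t"
      using exp_Ln[of "\<gamma> s / \<gamma> t"] nz \<gamma>(1)
      by (metis Arg_eq_Im_Ln cis_Arg divide_eq_0_iff div_by_1 norm_divide sgn_eq of_real_1)
    then show ?thesis
      using nz f(2) by (simp add: \<theta>_def cis_mult[symmetric])
  qed
  have "((\<lambda>s. \<gamma> s / \<gamma> t) has_vector_derivative b *\<^sub>R \<i>) (at t)"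
    using has_vector_derivative_divide[OF \<gamma>(2), of "\<gamma> t"] nz[of t]
    by (simp add: scaleR_conv_of_real)
  moreover have "(Ln has_field_derivative 1) (at (\<gamma> t / \<gamma> t))"
    using nz by (auto intro!: derivative_eq_intros)
  ultimately have "((Ln \<circ> (\<lambda>s. \<gamma> s / \<gamma> t)) has_vector_derivative (b *\<^sub>R \<i> * 1)) (at t)"
    by (rule field_vector_diff_chain_at)
  then have "((\<lambda>s. Im (Ln (\<gamma> s / \<gamma> t))) has_vector_derivative b) (at t)"
    using bounded_linear.has_vector_derivative[OF bounded_linear_Im] by (fastforce simp: o_def)
  then have "(\<theta> has_vector_derivative b) (at t)"
    unfolding \<theta>_def using has_vector_derivative_add[OF has_vector_derivative_const] by fastforce
  moreover have "\<theta> t = u" by (simp add: \<theta>_def nz)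
  ultimately have "((\<lambda>s. f (cis s)) \<circ> \<theta> has_vector_derivative b *\<^sub>R w) (at t)"
    using vector_diff_chain_at f(1) by metis
  then show ?thesis by (simp add: o_def cis\<theta>)
qed

lemma smooth_upto_comp:
  assumes "smooth_upto n (\<lambda>t. f (cis t))" "smooth_upto n \<gamma>" "\<And>t. norm (\<gamma> t) = 1"
  shows "smooth_upto n (\<lambda>t. f (\<gamma> t))"
  using assms(1,2)
proof (induction n arbitrary: f)
  case (Suc n)
  obtain F where F: "\<And>t. ((\<lambda>t. f (cis t)) has_vector_derivative F t) (at t)" "smooth_upto n F"
    using Suc.prems(1) smooth_upto_Suc by metis
  obtain \<gamma>' where \<gamma>': "\<And>t. (\<gamma> has_vector_derivative \<gamma>' t) (at t)" "smooth_upto n \<gamma>'"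
    using Suc.prems(2) smooth_upto_Suc by metis
  define f' where "f' z = F (Arg z)" for z
  have "((\<lambda>t. f (cis t)) has_vector_derivative 1 *\<^sub>R F (Arg (cis t))) (at t)" for t
    by (rule circle_chain_rule[where u = "Arg (cis t)"])
      (use F has_vector_derivative_cis cis_Arg_unit in auto)
  then have f'_cis: "(\<lambda>t. f' (cis t)) = F"
    using F(1) vector_derivative_unique_at by (fastforce simp: f'_def)
  have "((\<lambda>t. f (\<gamma> t)) has_vector_derivative Im (\<gamma>' t * cnj (\<gamma> t)) *\<^sub>R f' (\<gamma> t)) (at t)" for t
    unfolding f'_def
    by (rule circle_chain_rule[where u = "Arg (\<gamma> t)"])
      (use F \<gamma>' assms(3) cis_Arg_unit unit_curve_tangent[OF assms(3) \<gamma>'(1)] in auto)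
  moreover have "smooth_upto n (\<lambda>t. of_real (Im (\<gamma>' t * cnj (\<gamma> t))) * f' (\<gamma> t))"
  proof (rule smooth_upto_mult)
    have \<gamma>n: "smooth_upto n \<gamma>" using Suc.prems(2) smooth_upto_SucD by blast
    have L: "bounded_linear (\<lambda>z. complex_of_real (Im z))"
      by (rule bounded_linear_compose[OF bounded_linear_of_real bounded_linear_Im])
    show "smooth_upto n (\<lambda>t. of_real (Im (\<gamma>' t * cnj (\<gamma> t))))"
      by (rule smooth_upto_linear[OF L smooth_upto_mult
            [OF \<gamma>'(2) smooth_upto_linear[OF bounded_linear_cnj \<gamma>n]]])
    show "smooth_upto n (\<lambda>t. f' (\<gamma> t))"
      using Suc.IH[of f'] F(2) \<gamma>n by (simp add: f'_cis)
  qed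
  ultimately show ?case
    unfolding smooth_upto_Suc
    by (intro exI[of _ "\<lambda>t. Im (\<gamma>' t * cnj (\<gamma> t)) *\<^sub>R f' (\<gamma> t)"]) (auto simp: scaleR_conv_of_real)
qed simp

lemma smooth_curve_comp:
  "smooth_curve (\<lambda>t. f (cis t)) \<Longrightarrow> smooth_curve \<gamma> \<Longrightarrow> (\<And>t. norm (\<gamma> t) = 1) \<Longrightarrow>
    smooth_curve (\<lambda>t. f (\<gamma> t))"
  unfolding smooth_curve_iff_upto using smooth_upto_comp by blast

lemma orientation_preserving_diffeo_id: "orientation_preserving_diffeo (\<lambda>z. z)"
proof -
  have inv: "inv_into circle (\<lambda>z. z) (cis t) = cis t" for t
    by (rule inv_into_f_f) auto
  have "\<exists>a>0. (cis has_vector_derivative a *\<^sub>R (\<i> * cis t)) (at t)" for t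
    using has_vector_derivative_cis by (intro exI[of _ 1]) simp
  then show ?thesis
    unfolding orientation_preserving_diffeo_def inv
    using smooth_curve_cis bij_betw_id[of circle] by (auto simp: id_def)
qed

lemma orientation_preserving_diffeo_comp:
  assumes f: "orientation_preserving_diffeo f" and g: "orientation_preserving_diffeo g"
  shows "orientation_preserving_diffeo (\<lambda>z. g (f z))"
proof -
  have bij: "bij_betw f circle circle" "bij_betw g circle circle"
    using f g by (auto simp: orientation_preserving_diffeo_def)
  have fc: "norm (f (cis t)) = 1" and gi: "norm (inv_into circle g (cis t)) = 1" for t
    using bij_betwE[OF bij(1)] bij_betwE[OF bij_betw_inv_into[OF bij(2)]] by auto
  have gf: "bij_betw (\<lambda>z. g (f z)) circle circle"
    using bij_betw_trans[OF bij] by (simp add: o_def)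
  have inv: "inv_into circle (\<lambda>z. g (f z)) (cis t) = inv_into circle f (inv_into circle g (cis t))" for t
  proof (rule inv_into_f_eq)
    show "inj_on (\<lambda>z. g (f z)) circle" using gf bij_betw_def by blast
    show "inv_into circle f (inv_into circle g (cis t)) \<in> circle"
      using bij_betwE[OF bij_betw_inv_into[OF bij(1)]] gi by auto
    show "g (f (inv_into circle f (inv_into circle g (cis t)))) = cis t"
      using bij gi by (simp add: bij_betw_inv_into_right)
  qed
  have "\<exists>a>0. ((\<lambda>s. g (f (cis s))) has_vector_derivative a *\<^sub>R (\<i> * g (f (cis t)))) (at t)" for t
  proof -
    obtain a where a: "a > 0" "((\<lambda>s. f (cis s)) has_vector_derivative a *\<^sub>R (\<i> * f (cis t))) (at t)"
      using f by (auto simp: orientation_preserving_diffeo_def)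
    define u where "u = Arg (f (cis t))"
    have u: "cis u = f (cis t)"
      using fc[of t] by (simp add: u_def cis_Arg_unit)
    obtain b where b: "b > 0" "((\<lambda>s. g (cis s)) has_vector_derivative b *\<^sub>R (\<i> * g (cis u))) (at u)"
      using g by (auto simp: orientation_preserving_diffeo_def)
    have "((\<lambda>s. g (f (cis s))) has_vector_derivative a *\<^sub>R (b *\<^sub>R (\<i> * g (cis u)))) (at t)"
      using circle_chain_rule[OF fc a(2) b(2) u] .
    with a(1) b(1) show ?thesis
      by (intro exI[of _ "a * b"]) (simp add: u)
  qed
  moreover have "smooth_curve (\<lambda>t. g (f (cis t)))"
    using f g fc by (auto simp: orientation_preserving_diffeo_def intro: smooth_curve_comp)
  moreover have "smooth_curve (\<lambda>t. inv_into circle f (inv_into circle g (cis t)))"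
    using f g gi
    by (auto simp: orientation_preserving_diffeo_def intro!: smooth_curve_comp[of "inv_into circle f"])
  ultimately show ?thesis
    unfolding orientation_preserving_diffeo_def inv using gf by blast
qed

lemma orientation_preserving_diffeo_inv:
  assumes f: "orientation_preserving_diffeo f"
  shows "orientation_preserving_diffeo (inv_into circle f)"
proof -
  let ?g = "inv_into circle f"
  have bij: "bij_betw f circle circle" and g: "bij_betw ?g circle circle"
    using f bij_betw_inv_into by (auto simp: orientation_preserving_diffeo_def)
  have gc: "norm (?g (cis t)) = 1" for t
    using bij_betwE[OF g] by auto
  have fg: "f (?g (cis t)) = cis t" for t
    using bij by (simp add: bij_betw_inv_into_right)
  have inv: "inv_into circle ?g (cis t) = f (cis t)" for t
    using bij by (simp add: inv_into_inv_into_eq)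
  have sm: "smooth_curve (\<lambda>t. ?g (cis t))"
    using f by (simp add: orientation_preserving_diffeo_def)
  have "\<exists>a>0. ((\<lambda>s. ?g (cis s)) has_vector_derivative a *\<^sub>R (\<i> * ?g (cis t))) (at t)" for t
  proof -
    have "smooth_upto (Suc 0) (\<lambda>t. ?g (cis t))"
      using sm by (simp add: smooth_curve_iff_upto)
    then obtain v where v: "((\<lambda>s. ?g (cis s)) has_vector_derivative v) (at t)"
      using smooth_upto_Suc by blast
    obtain a where "v = a *\<^sub>R (\<i> * ?g (cis t))"
      using unit_curve_tangent[OF gc v] by blast
    with v have a: "((\<lambda>s. ?g (cis s)) has_vector_derivative a *\<^sub>R (\<i> * ?g (cis t))) (at t)"
      by blast
    define u where "u = Arg (?g (cis t))"
    have u: "cis u = ?g (cis t)"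
      using gc[of t] by (simp add: u_def cis_Arg_unit)
    obtain b where b: "b > 0" "((\<lambda>s. f (cis s)) has_vector_derivative b *\<^sub>R (\<i> * f (cis u))) (at u)"
      using f by (auto simp: orientation_preserving_diffeo_def)
    have "((\<lambda>s. f (?g (cis s))) has_vector_derivative a *\<^sub>R (b *\<^sub>R (\<i> * f (cis u)))) (at t)"
      using circle_chain_rule[OF gc a b(2) u] .
    then have "(cis has_vector_derivative (a * b) *\<^sub>R (\<i> * cis t)) (at t)"
      by (simp add: u fg)
    then have "(a * b) *\<^sub>R (\<i> * cis t) = \<i> * cis t"
      using has_vector_derivative_cis vector_derivative_unique_at by blast
    then have "a * b = 1"
      by (simp add: scaleR_conv_of_real del: of_real_mult)
    then have "a > 0" using b(1) by (metis zero_less_mult_pos2 zero_less_one)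
    with a show ?thesis by blast
  qed
  then show ?thesis
    unfolding orientation_preserving_diffeo_def inv
    using f g by (auto simp: orientation_preserving_diffeo_def)
qed


section \<open>Framed chord diagrams\<close>

text \<open>
  A collection of framed chords is the partial function that assigns to each chord, i.e. to each
  two-element set of endpoints, its framing in \<open>\<int>/2\<int>\<close>; its domain is the set of chords.  Framing
  \<open>0\<close> means oriented, framing \<open>1\<close> disorienting.
\<close>

type_synonym chords = "complex set \<rightharpoonup> bit"

definition framed_chords :: "chords \<Rightarrow> bool" where
  "framed_chords d \<longleftrightarrow>
    finite (dom d) \<and> disjoint (dom d) \<and> (\<forall>c\<in>dom d. c \<subseteq> circle \<and> card c = 2)"

definition all_oriented :: "chords \<Rightarrow> bool" where
  "all_oriented d \<longleftrightarrow> (\<forall>c\<in>dom d. d c = Some 0)"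

definition diffeomorphic :: "chords \<Rightarrow> chords \<Rightarrow> bool" where
  "diffeomorphic d e \<longleftrightarrow> framed_chords d \<and> framed_chords e \<and>
    (\<exists>f. orientation_preserving_diffeo f \<and>
      dom e = (\<lambda>c. f ` c) ` dom d \<and> (\<forall>c\<in>dom d. e (f ` c) = d c))"

lemma diffeomorphicI:
  "orientation_preserving_diffeo f \<Longrightarrow> dom e = (\<lambda>c. f ` c) ` dom d \<Longrightarrow>
    (\<And>c. c \<in> dom d \<Longrightarrow> e (f ` c) = d c) \<Longrightarrow> framed_chords d \<Longrightarrow> framed_chords e \<Longrightarrow>
    diffeomorphic d e"
  unfolding diffeomorphic_def by (intro conjI exI[of _ f]) simp_all

lemma diffeomorphicE:
  assumes "diffeomorphic d e"
  obtains f where "orientation_preserving_diffeo f" "dom e = (\<lambda>c. f ` c) ` dom d"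
    "\<And>c. c \<in> dom d \<Longrightarrow> e (f ` c) = d c" "framed_chords d" "framed_chords e"
  using assms unfolding diffeomorphic_def by auto

lemma diffeomorphic_refl: "framed_chords d \<Longrightarrow> diffeomorphic d d"
  by (rule diffeomorphicI[OF orientation_preserving_diffeo_id]) simp_all

lemma diffeomorphic_sym:
  assumes "diffeomorphic d e"
  shows "diffeomorphic e d"
  using assms
proof (rule diffeomorphicE)
  fix f
  assume f: "orientation_preserving_diffeo f"
    and e: "dom e = (\<lambda>c. f ` c) ` dom d" "\<And>c. c \<in> dom d \<Longrightarrow> e (f ` c) = d c"
    and de: "framed_chords d" "framed_chords e"
  let ?g = "inv_into circle f"
  have inj: "inj_on f circle"
    using f by (simp add: orientation_preserving_diffeo_def bij_betw_def)
  have gf: "?g ` f ` c = c" if "c \<in> dom d" for c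
    by (rule inv_into_image_cancel[OF inj]) (use that de(1) in \<open>simp add: framed_chords_def\<close>)
  show ?thesis
  proof (rule diffeomorphicI[OF orientation_preserving_diffeo_inv[OF f]])
    have "(\<lambda>c. ?g ` c) ` dom e = (\<lambda>c. ?g ` f ` c) ` dom d"
      unfolding e(1) by (rule image_image)
    also have "\<dots> = (\<lambda>c. c) ` dom d" using gf by (rule image_cong[OF refl])
    finally show "dom d = (\<lambda>c. ?g ` c) ` dom e" by simp
    show "d (?g ` c) = e c" if c: "c \<in> dom e" for c
    proof -
      obtain c' where "c' \<in> dom d" "c = f ` c'" using c unfolding e(1) by (rule imageE)
      then show ?thesis using gf e(2) by simp
    qed
  qed (rule de)+
qed

lemma diffeomorphic_trans:
  assumes de: "diffeomorphic d e" and eh: "diffeomorphic e h"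
  shows "diffeomorphic d h"
  using de
proof (rule diffeomorphicE)
  fix f
  assume f: "orientation_preserving_diffeo f" "dom e = (\<lambda>c. f ` c) ` dom d"
    "\<And>c. c \<in> dom d \<Longrightarrow> e (f ` c) = d c" "framed_chords d"
  show ?thesis
    using eh
  proof (rule diffeomorphicE)
    fix g
    assume g: "orientation_preserving_diffeo g" "dom h = (\<lambda>c. g ` c) ` dom e"
      "\<And>c. c \<in> dom e \<Longrightarrow> h (g ` c) = e c" "framed_chords h"
    have im: "(\<lambda>z. g (f z)) ` c = g ` f ` c" for c by (simp add: image_image)
    show ?thesis
    proof (rule diffeomorphicI[OF orientation_preserving_diffeo_comp[OF f(1) g(1)]])
      show "dom h = (\<lambda>c. (\<lambda>z. g (f z)) ` c) ` dom d"
        unfolding im g(2) f(2) by (rule image_image)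
      show "h ((\<lambda>z. g (f z)) ` c) = d c" if "c \<in> dom d" for c
        unfolding im using f(2,3) g(3) that by simp
    qed (rule f g)+
  qed
qed

lemma framed_chords_empty: "framed_chords (\<lambda>_. None)"
  by (simp add: framed_chords_def)

quotient_type framed_chord_diagram = chords / partial: diffeomorphic
proof (rule part_equivpI)
  show "\<exists>d. diffeomorphic d d"
    by (rule exI, rule diffeomorphic_refl, rule framed_chords_empty)
  show "symp diffeomorphic" by (rule sympI) (rule diffeomorphic_sym)
  show "transp diffeomorphic" by (rule transpI) (rule diffeomorphic_trans)
qed

text \<open>Ordinary chord diagrams are the framed ones all of whose chords are oriented.\<close>

quotient_type chord_diagram =
  chords / partial: "\<lambda>d e. all_oriented d \<and> all_oriented e \<and> diffeomorphic d e"
proof (rule part_equivpI)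
  have "all_oriented (\<lambda>_. None)" by (simp add: all_oriented_def)
  then show "\<exists>d. all_oriented d \<and> all_oriented d \<and> diffeomorphic d d"
    using diffeomorphic_refl[OF framed_chords_empty] by blast
  show "symp (\<lambda>d e. all_oriented d \<and> all_oriented e \<and> diffeomorphic d e)"
    by (rule sympI) (simp add: diffeomorphic_sym)
  show "transp (\<lambda>d e. all_oriented d \<and> all_oriented e \<and> diffeomorphic d e)"
    by (rule transpI) (elim conjE, intro conjI, assumption+, rule diffeomorphic_trans)
qed

section \<open>The 4T-relations\<close>

definition endpoints :: "chords \<Rightarrow> complex set" where
  "endpoints d = \<Union> (dom d)"

text \<open>\<open>x\<close> precedes (succeeds) \<open>p\<close> and neither \<open>x\<close> nor any point between \<open>x\<close> and \<open>p\<close> is in \<open>E\<close>.\<close>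

definition just_before :: "complex set \<Rightarrow> complex \<Rightarrow> complex \<Rightarrow> bool" where
  "just_before E p x \<longleftrightarrow> (\<exists>\<epsilon>>0. x = p * cis (- \<epsilon>) \<and> (\<forall>s\<in>{0<..\<epsilon>}. p * cis (- s) \<notin> E))"

definition just_after :: "complex set \<Rightarrow> complex \<Rightarrow> complex \<Rightarrow> bool" where
  "just_after E p x \<longleftrightarrow> (\<exists>\<epsilon>>0. x = p * cis \<epsilon> \<and> (\<forall>s\<in>{0<..\<epsilon>}. p * cis s \<notin> E))"

text \<open>The distinguished chord is \<open>{p, q}\<close>, and \<open>r\<close> is the fixed endpoint of the jumping chord.\<close>

definition fourT_position ::
    "chords \<Rightarrow> complex \<Rightarrow> complex \<Rightarrow> complex \<Rightarrow> complex \<Rightarrow> complex \<Rightarrow> complex \<Rightarrow> complex \<Rightarrow> bool"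
where
  "fourT_position d p q r pm pp qm qp \<longleftrightarrow>
    framed_chords d \<and> {p, q} \<in> dom d \<and> r \<in> circle \<and> r \<notin> endpoints d \<and>
    (let E = insert r (endpoints d) in
      just_before E p pm \<and> just_after E p pp \<and> just_before E q qm \<and> just_after E q qp)"

definition jump :: "chords \<Rightarrow> complex \<Rightarrow> bit \<Rightarrow> complex \<Rightarrow> framed_chord_diagram \<Rightarrow>\<^sub>0 'k::field" where
  "jump d r \<phi> x = Poly_Mapping.single (abs_framed_chord_diagram (d({r, x} \<mapsto> \<phi>))) 1"

definition ordinary_jump :: "chords \<Rightarrow> complex \<Rightarrow> complex \<Rightarrow> chord_diagram \<Rightarrow>\<^sub>0 'k::field" where
  "ordinary_jump d r x = Poly_Mapping.single (abs_chord_diagram (d({r, x} \<mapsto> 0))) 1"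

inductive_set framed_4T :: "(framed_chord_diagram \<Rightarrow>\<^sub>0 'k::field) set" where
  oriented: "fourT_position d p q r pm pp qm qp \<Longrightarrow> d {p, q} = Some 0 \<Longrightarrow>
    (jump d r \<phi> pm - jump d r \<phi> pp) - (jump d r \<phi> qp - jump d r \<phi> qm) \<in> framed_4T"
| disorienting: "fourT_position d p q r pm pp qm qp \<Longrightarrow> d {p, q} = Some 1 \<Longrightarrow>
    (jump d r \<phi> pm - jump d r \<phi> pp) - (jump d r (\<phi> + 1) qm - jump d r (\<phi> + 1) qp) \<in> framed_4T"

inductive_set ordinary_4T :: "(chord_diagram \<Rightarrow>\<^sub>0 'k::field) set" where
  "fourT_position d p q r pm pp qm qp \<Longrightarrow> all_oriented d \<Longrightarrow>
    (ordinary_jump d r pm - ordinary_jump d r pp) -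
      (ordinary_jump d r qp - ordinary_jump d r qm) \<in> ordinary_4T"

section \<open>The spaces \<open>\<M>\<close> and \<open>\<A>\<close>\<close>

text \<open>\<open>'a \<Rightarrow>\<^sub>0 'k\<close> with the following scaling is the vector space with basis \<open>'a\<close>.\<close>

definition free_scale :: "'k::field \<Rightarrow> ('a \<Rightarrow>\<^sub>0 'k) \<Rightarrow> 'a \<Rightarrow>\<^sub>0 'k" where
  "free_scale a = Poly_Mapping.map ((*) a)"

lemma lookup_free_scale [simp]:
  "Poly_Mapping.lookup (free_scale a x) i = a * Poly_Mapping.lookup x i"
  by (simp add: free_scale_def Poly_Mapping.map.rep_eq when_def)

interpretation free_space: vector_space free_scale
  by standard (auto intro!: poly_mapping_eqI simp: lookup_add algebra_simps)

definition congruent_mod ::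
    "('a \<Rightarrow>\<^sub>0 'k::field) set \<Rightarrow> ('a \<Rightarrow>\<^sub>0 'k) \<Rightarrow> ('a \<Rightarrow>\<^sub>0 'k) \<Rightarrow> bool" where
  "congruent_mod R x y \<longleftrightarrow> x - y \<in> free_space.span R"

lemma congruent_mod_refl: "congruent_mod R x x"
  by (simp add: congruent_mod_def free_space.span_zero)

lemma equivp_congruent_mod: "equivp (congruent_mod R)"
proof (rule equivpI)
  show "reflp (congruent_mod R)" by (simp add: reflp_def congruent_mod_refl)
  show "symp (congruent_mod R)"
    unfolding symp_def congruent_mod_def using free_space.span_neg by fastforce
  show "transp (congruent_mod R)"
  proof (rule transpI)
    fix x y z
    assume "congruent_mod R x y" "congruent_mod R y z"
    then have "(x - y) + (y - z) \<in> free_space.span R"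
      unfolding congruent_mod_def by (rule free_space.span_add)
    then show "congruent_mod R x z" by (simp add: congruent_mod_def)
  qed
qed

lemma congruent_mod_add:
  "congruent_mod R x y \<Longrightarrow> congruent_mod R x' y' \<Longrightarrow> congruent_mod R (x + x') (y + y')"
  unfolding congruent_mod_def add_diff_add by (rule free_space.span_add)

lemma congruent_mod_scale:
  "congruent_mod R x y \<Longrightarrow> congruent_mod R (free_scale a x) (free_scale a y)"
  unfolding congruent_mod_def free_space.scale_right_diff_distrib[symmetric]
  by (rule free_space.span_scale)

lemma congruent_mod_minus: "congruent_mod R x y \<Longrightarrow> congruent_mod R (- x) (- y)"
  using congruent_mod_scale[of R x y "- 1"] by simp

lemma congruent_mod_diff:
  "congruent_mod R x y \<Longrightarrow> congruent_mod R x' y' \<Longrightarrow> congruent_mod R (x - x') (y - y')"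
  using congruent_mod_add[of R x y "- x'" "- y'"] congruent_mod_minus[of R x' y'] by simp

quotient_type (overloaded) 'k framed_chord_space =
  "framed_chord_diagram \<Rightarrow>\<^sub>0 'k::field_char_0" / "congruent_mod framed_4T"
  by (rule equivp_congruent_mod)

instantiation framed_chord_space :: (field_char_0) ab_group_add
begin

lift_definition zero_framed_chord_space :: "'a framed_chord_space" is 0 .
lift_definition plus_framed_chord_space :: "'a framed_chord_space \<Rightarrow> 'a framed_chord_space \<Rightarrow> 'a framed_chord_space"
  is "(+)" by (rule congruent_mod_add)
lift_definition uminus_framed_chord_space :: "'a framed_chord_space \<Rightarrow> 'a framed_chord_space"
  is uminus by (rule congruent_mod_minus)
lift_definition minus_framed_chord_space :: "'a framed_chord_space \<Rightarrow> 'a framed_chord_space \<Rightarrow> 'a framed_chord_space"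
  is "(-)" by (rule congruent_mod_diff)

instance
  by (standard; transfer) (simp_all add: algebra_simps congruent_mod_refl)

end

lift_definition scaleM :: "'k::field_char_0 \<Rightarrow> 'k framed_chord_space \<Rightarrow> 'k framed_chord_space"
  is free_scale by (rule congruent_mod_scale)

interpretation space_M: vector_space scaleM
  by (standard; transfer) (simp_all add: algebra_simps congruent_mod_refl
      free_space.scale_right_distrib free_space.scale_left_distrib)

definition classM :: "framed_chord_diagram \<Rightarrow> 'k::field_char_0 framed_chord_space" where
  "classM d = abs_framed_chord_space (Poly_Mapping.single d 1)"

quotient_type (overloaded) 'k chord_space =
  "chord_diagram \<Rightarrow>\<^sub>0 'k::field_char_0" / "congruent_mod ordinary_4T"
  by (rule equivp_congruent_mod)

instantiation chord_space :: (field_char_0) ab_group_add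
begin

lift_definition zero_chord_space :: "'a chord_space" is 0 .
lift_definition plus_chord_space :: "'a chord_space \<Rightarrow> 'a chord_space \<Rightarrow> 'a chord_space"
  is "(+)" by (rule congruent_mod_add)
lift_definition uminus_chord_space :: "'a chord_space \<Rightarrow> 'a chord_space"
  is uminus by (rule congruent_mod_minus)
lift_definition minus_chord_space :: "'a chord_space \<Rightarrow> 'a chord_space \<Rightarrow> 'a chord_space"
  is "(-)" by (rule congruent_mod_diff)

instance
  by (standard; transfer) (simp_all add: algebra_simps congruent_mod_refl)

end

lift_definition scaleA :: "'k::field_char_0 \<Rightarrow> 'k chord_space \<Rightarrow> 'k chord_space"
  is free_scale by (rule congruent_mod_scale)

interpretation space_A: vector_space scaleA
  by (standard; transfer) (simp_all add: algebra_simps congruent_mod_refl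
      free_space.scale_right_distrib free_space.scale_left_distrib)

definition classA :: "chord_diagram \<Rightarrow> 'k::field_char_0 chord_space" where
  "classA d = abs_chord_space (Poly_Mapping.single d 1)"

section \<open>Discoloration\<close>

definition num_disorienting :: "chords \<Rightarrow> nat" where
  "num_disorienting d = card {c \<in> dom d. d c = Some 1}"

definition forget_framing :: "chords \<Rightarrow> chords" where
  "forget_framing d = (\<lambda>c. if c \<in> dom d then Some 0 else None)"

end

theory Submission
  imports Defs
begin

text \<open>
  All four diagrams of a framed 4T-relation discolor to the corresponding ordinary diagrams, with
  the common sign \<open>(-1)\<^sup>w\<close> when \<open>v\<close> is oriented.  When \<open>v\<close> is disorienting, the right-hand side has
  the framing of the jumping chord shifted by one, hence an additional sign, and this turns
  \<open>q\<^sup>- - q\<^sup>+\<close> into the \<open>q\<^sup>+ - q\<^sup>-\<close> of the ordinary relation.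
\<close>

section \<open>The basis of diagrams in the free vector space\<close>

abbreviation basis_vector :: "'a \<Rightarrow> 'a \<Rightarrow>\<^sub>0 'k::field" where
  "basis_vector i \<equiv> Poly_Mapping.single i 1"

lemma inj_basis_vector: "inj basis_vector"
  by (rule injI) (metis lookup_single_eq lookup_single_not_eq zero_neq_one)

text \<open>Reading off the coefficient at \<open>i\<close> of a vanishing combination isolates the
  scalar of \<open>basis_vector i\<close>. Independence allows values chosen on diagrams to be
  extended linearly.\<close>

lemma independent_basis_vectors:
  "free_space.independent (range (basis_vector :: 'a \<Rightarrow> 'a \<Rightarrow>\<^sub>0 'k::field))"
  unfolding free_space.independent_explicit_module
proof (intro allI impI)
  fix t :: "('a \<Rightarrow>\<^sub>0 'k) set" and u v
  assume t: "finite t" "t \<subseteq> range basis_vector" "(\<Sum>w\<in>t. free_scale (u w) w) = 0" "v \<in> t"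
  then obtain i where i: "v = basis_vector i" by blast
  have coeff: "u w * Poly_Mapping.lookup w i = (if w = v then u v else 0)" if "w \<in> t" for w
  proof -
    obtain j where "w = basis_vector j" using \<open>w \<in> t\<close> t(2) by blast
    then show ?thesis using i by (auto simp: inj_eq[OF inj_basis_vector] lookup_single when_def)
  qed
  have "0 = Poly_Mapping.lookup (\<Sum>w\<in>t. free_scale (u w) w) i"
    by (simp add: t(3))
  also have "\<dots> = u v"
    using t(1,4) by (simp add: lookup_sum coeff)
  finally show "u v = 0" by simp
qed

lemma span_basis_vectors: "free_space.span (range basis_vector) = UNIV"
proof -
  have "x \<in> free_space.span (range basis_vector)" for x :: "'a \<Rightarrow>\<^sub>0 'k::field"
  proof -
    have "x = (\<Sum>i\<in>Poly_Mapping.keys x. free_scale (Poly_Mapping.lookup x i) (basis_vector i))"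
      by (rule poly_mapping_eqI)
        (auto simp: lookup_sum lookup_single when_def not_in_keys_iff_lookup_eq_zero if_distrib
          sum.delta' cong: if_cong)
    also have "\<dots> \<in> free_space.span (range basis_vector)"
      by (intro free_space.span_sum free_space.span_scale free_space.span_base rangeI)
    finally show ?thesis .
  qed
  then show ?thesis by blast
qed

section \<open>Discoloration of a single diagram\<close>

lemma diffeomorphic_rep_abs:
  "framed_chords d \<Longrightarrow> diffeomorphic (rep_framed_chord_diagram (abs_framed_chord_diagram d)) d"
  by (rule rep_abs_rsp_left[OF Quotient3_framed_chord_diagram diffeomorphic_refl])

text \<open>The quotient is partial: the chosen representative is related to itself, and
  \<open>diffeomorphic\<close> includes \<open>framed_chords\<close>.\<close>

lemma abs_framed_chord_diagram_cases:
  obtains d where "framed_chords d" "D = abs_framed_chord_diagram d"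
proof
  show "framed_chords (rep_framed_chord_diagram D)"
    using Quotient3_rep_reflp[OF Quotient3_framed_chord_diagram] diffeomorphic_def by blast
  show "D = abs_framed_chord_diagram (rep_framed_chord_diagram D)"
    by (simp add: Quotient3_abs_rep[OF Quotient3_framed_chord_diagram])
qed

lemma dom_forget_framing [simp]: "dom (forget_framing d) = dom d"
  by (rule set_eqI) (simp add: forget_framing_def domIff)

lemma forget_framing_apply: "c \<in> dom d \<Longrightarrow> forget_framing d c = Some 0"
  by (simp add: forget_framing_def)

lemma framed_chords_forget_framing [simp]: "framed_chords (forget_framing d) = framed_chords d"
  by (simp add: framed_chords_def)

lemma endpoints_forget_framing [simp]: "endpoints (forget_framing d) = endpoints d"
  by (simp add: endpoints_def)

lemma all_oriented_forget_framing: "all_oriented (forget_framing d)"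
  by (simp add: all_oriented_def forget_framing_apply)

lemma forget_framing_upd: "forget_framing (d(c \<mapsto> \<phi>)) = (forget_framing d)(c \<mapsto> 0)"
  by (auto simp: forget_framing_def)

text \<open>The same diffeomorphism serves, since all framings have become \<open>0\<close>.\<close>

lemma diffeomorphic_forget_framing:
  assumes "diffeomorphic d e"
  shows "abs_chord_diagram (forget_framing d) = abs_chord_diagram (forget_framing e)"
proof (rule Quotient3_rel_abs[OF Quotient3_chord_diagram], intro conjI all_oriented_forget_framing)
  obtain f where f: "orientation_preserving_diffeo f" "dom e = (\<lambda>c. f ` c) ` dom d"
    "\<And>c. c \<in> dom d \<Longrightarrow> e (f ` c) = d c" "framed_chords d" "framed_chords e"
    using assms unfolding diffeomorphic_def by auto
  show "diffeomorphic (forget_framing d) (forget_framing e)"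
    by (rule diffeomorphicI[OF f(1)]) (simp_all add: f forget_framing_apply)
qed

text \<open>A diffeomorphism is injective on the circle, hence on chords, and respects framings, so
  it restricts to a bijection between the disorienting chords.\<close>

lemma diffeomorphic_num_disorienting:
  assumes "diffeomorphic d e"
  shows "num_disorienting d = num_disorienting e"
proof -
  obtain f where f: "orientation_preserving_diffeo f" "dom e = (\<lambda>c. f ` c) ` dom d"
    "\<And>c. c \<in> dom d \<Longrightarrow> e (f ` c) = d c" "framed_chords d" "framed_chords e"
    using assms unfolding diffeomorphic_def by auto
  have "inj_on f circle"
    using f(1) by (simp add: orientation_preserving_diffeo_def bij_betw_def)
  then have "inj_on (\<lambda>c. f ` c) (dom d)"
    by (rule inj_on_subset[OF inj_on_image_Pow]) (use f(4) in \<open>auto simp: framed_chords_def\<close>)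
  then have "inj_on (\<lambda>c. f ` c) {c \<in> dom d. d c = Some 1}"
    by (rule inj_on_subset) blast
  moreover have "{c \<in> dom e. e c = Some 1} = (\<lambda>c. f ` c) ` {c \<in> dom d. d c = Some 1}"
    unfolding f(2) using f(3) by force
  ultimately show ?thesis by (simp add: num_disorienting_def card_image)
qed

text \<open>The two invariance lemmas above make the choice of representative harmless, as
  \<open>discolor_abs\<close> records.\<close>

definition discolor :: "framed_chord_diagram \<Rightarrow> 'k::field_char_0 chord_space" where
  "discolor D = scaleA ((- 1) ^ num_disorienting (rep_framed_chord_diagram D))
    (classA (abs_chord_diagram (forget_framing (rep_framed_chord_diagram D))))"

lemma discolor_abs:
  "framed_chords d \<Longrightarrow> discolor (abs_framed_chord_diagram d) =
    scaleA ((- 1) ^ num_disorienting d) (classA (abs_chord_diagram (forget_framing d)))"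
  using diffeomorphic_rep_abs diffeomorphic_num_disorienting diffeomorphic_forget_framing
  unfolding discolor_def by metis

section \<open>Discoloration of the 4T-relations\<close>

lemma fourT_position_forget_framing:
  "fourT_position d p q r pm pp qm qp \<Longrightarrow> fourT_position (forget_framing d) p q r pm pp qm qp"
  by (simp add: fourT_position_def)

text \<open>The range of \<open>s\<close> in \<open>just_before\<close> includes
  \<open>\<epsilon>\<close>, so \<open>x\<close> itself avoids \<open>E\<close>; rotation keeps it
  on the circle.\<close>

lemma just_beforeD: "just_before E p x \<Longrightarrow> p \<in> circle \<Longrightarrow> x \<in> circle \<and> x \<notin> E"
  by (auto simp: just_before_def norm_mult)

lemma just_afterD: "just_after E p x \<Longrightarrow> p \<in> circle \<Longrightarrow> x \<in> circle \<and> x \<notin> E"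
  by (auto simp: just_after_def norm_mult)

lemma fourT_position_points:
  assumes "fourT_position d p q r pm pp qm qp" "x \<in> {pm, pp, qm, qp}"
  shows "x \<in> circle \<and> x \<notin> insert r (endpoints d)"
proof -
  have "p \<in> circle" "q \<in> circle"
    using assms(1) unfolding fourT_position_def framed_chords_def by blast+
  then show ?thesis
    using assms just_beforeD just_afterD unfolding fourT_position_def Let_def by blast
qed

text \<open>\<open>r\<close> and \<open>x\<close> are distinct and neither is an old endpoint, so
  the new chord has two endpoints and meets no other chord.\<close>

lemma framed_chords_upd:
  assumes "framed_chords d" "r \<in> circle" "r \<notin> endpoints d" "x \<in> circle" "x \<notin> insert r (endpoints d)"
  shows "framed_chords (d({r, x} \<mapsto> \<phi>))"
  using assms unfolding framed_chords_def endpoints_def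
  by (auto simp: pairwise_insert disjnt_def)

lemma num_disorienting_upd:
  assumes "finite (dom d)" "c \<notin> dom d"
  shows "num_disorienting (d(c \<mapsto> \<phi>)) = num_disorienting d + (if \<phi> = 1 then 1 else 0)"
proof -
  have "{b \<in> dom (d(c \<mapsto> \<phi>)). (d(c \<mapsto> \<phi>)) b = Some 1} =
      (if \<phi> = 1 then insert c {b \<in> dom d. d b = Some 1} else {b \<in> dom d. d b = Some 1})"
    using assms(2) by (auto split: if_splits)
  then show ?thesis
    using assms by (simp add: num_disorienting_def)
qed

text \<open>The sign coming from \<open>d\<close> is the same at all four positions; only the
  framing of the jumping chord can change it.\<close>

lemma discolor_jump:
  fixes \<phi> :: bit
  assumes "fourT_position d p q r pm pp qm qp" "x \<in> {pm, pp, qm, qp}"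
  shows "discolor (abs_framed_chord_diagram (d({r, x} \<mapsto> \<phi>))) =
    scaleA ((- 1) ^ num_disorienting d * (if \<phi> = 1 then - 1 else 1))
      (classA (abs_chord_diagram ((forget_framing d)({r, x} \<mapsto> 0))))"
proof -
  have d: "framed_chords d" "r \<in> circle" "r \<notin> endpoints d"
    using assms(1) by (simp_all add: fourT_position_def)
  have x: "x \<in> circle" "x \<notin> insert r (endpoints d)"
    using fourT_position_points[OF assms] by simp_all
  \<comment> \<open>If \<open>{r, x}\<close> were a chord of \<open>d\<close>, then \<open>r\<close>
    would be an endpoint.\<close>
  have "{r, x} \<notin> dom d" "finite (dom d)"
    using d by (auto simp: endpoints_def framed_chords_def)
  then show ?thesis
    by (simp add: discolor_abs framed_chords_upd[OF d x] num_disorienting_upd forget_framing_upd)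
qed

text \<open>Generators of the relations vanish in the quotient, so the ordinary 4T-relation becomes
  an equation between classes.\<close>

lemma ordinary_4T_chord_space:
  assumes "fourT_position d p q r pm pp qm qp" "all_oriented d"
  defines "J \<equiv> \<lambda>x. classA (abs_chord_diagram (d({r, x} \<mapsto> 0))) :: 'k::field_char_0 chord_space"
  shows "J pm - J pp = J qp - J qm"
proof -
  have "congruent_mod (ordinary_4T :: (chord_diagram \<Rightarrow>\<^sub>0 'k) set)
      (ordinary_jump d r pm - ordinary_jump d r pp) (ordinary_jump d r qp - ordinary_jump d r qm)"
    unfolding congruent_mod_def
    by (rule free_space.span_base, rule ordinary_4T.intros[OF assms(1,2)])
  then show ?thesis
    by (simp add: J_def classA_def minus_chord_space.abs_eq chord_space.abs_eq_iff
        ordinary_jump_def)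
qed

lemma vanishes_on_framed_4T:
  fixes g :: "(framed_chord_diagram \<Rightarrow>\<^sub>0 'k::field_char_0) \<Rightarrow> 'k chord_space"
  assumes "Vector_Spaces.linear free_scale scaleA g" "\<And>D. g (basis_vector D) = discolor D"
    and "x \<in> framed_4T"
  shows "g x = 0"
proof -
  interpret g: Vector_Spaces.linear free_scale scaleA g by (rule assms(1))
  have g_jump: "g (jump d r \<phi> x) =
      scaleA ((- 1) ^ num_disorienting d * (if \<phi> = 1 then - 1 else 1))
        (classA (abs_chord_diagram ((forget_framing d)({r, x} \<mapsto> 0))))"
    if "fourT_position d p q r pm pp qm qp" "x \<in> {pm, pp, qm, qp}" for d p q r pm pp qm qp \<phi> x
    unfolding jump_def assms(2) by (rule discolor_jump[OF that])
  \<comment> \<open>Positions do not depend on framings, so the ordinary relation applies to the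
    discolored configuration even if the distinguished chord was disorienting.\<close>
  note relation = ordinary_4T_chord_space[OF fourT_position_forget_framing all_oriented_forget_framing]
  show ?thesis
    using assms(3)
  proof cases
    case (oriented d p q r pm pp qm qp \<phi>)
    \<comment> \<open>Solved for the term at \<open>pm\<close>, the relation is a rewrite rule after
      which everything cancels.\<close>
    note J_pm = relation[OF oriented(2), THEN iffD1[OF diff_eq_eq]]
    show ?thesis
      unfolding oriented(1)
      by (simp add: g.diff g_jump[OF oriented(2)] J_pm
          space_A.scale_right_distrib space_A.scale_right_diff_distrib)
  next
    case (disorienting d p q r pm pp qm qp \<phi>)
    note J_pm = relation[OF disorienting(2), THEN iffD1[OF diff_eq_eq]]
    show ?thesis
      unfolding disorienting(1)
      \<comment> \<open>Exactly one of \<open>\<phi>\<close> and \<open>\<phi> + 1\<close> is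
        \<open>1\<close>, so the two sides carry opposite signs.\<close>
      by (cases \<phi>) (simp_all add: g.diff g_jump[OF disorienting(2)] J_pm
          space_A.scale_right_distrib space_A.scale_right_diff_distrib)
  qed
qed

section \<open>Descent to the quotient and uniqueness\<close>

lemma linear_abs_framed_chord_space:
  "Vector_Spaces.linear free_scale scaleM abs_framed_chord_space"
  by unfold_locales (simp_all add: plus_framed_chord_space.abs_eq scaleM.abs_eq)

text \<open>Well-definedness is expressed as unique existence of a linear map with the prescribed
  values. Demanding the formula for every \<open>d\<close> includes independence of the
  representative.\<close>

theorem proposition3p1:
  shows "\<exists>!D_M :: 'k::field_char_0 framed_chord_space \<Rightarrow> 'k chord_space.
    Vector_Spaces.linear scaleM scaleA D_M \<and>
    (\<forall>d. framed_chords d \<longrightarrow>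
      D_M (classM (abs_framed_chord_diagram d)) =
        scaleA ((- 1) ^ num_disorienting d) (classA (abs_chord_diagram (forget_framing d))))"
proof -
  let ?abs = "abs_framed_chord_space :: (framed_chord_diagram \<Rightarrow>\<^sub>0 'k) \<Rightarrow> 'k framed_chord_space"
  note abs_rep = Quotient3_abs_rep[OF Quotient3_framed_chord_space]
  interpret FA: vector_space_pair free_scale "scaleA :: 'k \<Rightarrow> _" by unfold_locales
  \<comment> \<open>Every diagram is represented by some framed collection, so the formula for all
    \<open>d\<close> amounts to prescribing values on the basis of diagrams.\<close>
  have determined: "(\<forall>d. framed_chords d \<longrightarrow> D_M (classM (abs_framed_chord_diagram d)) =
        scaleA ((- 1) ^ num_disorienting d) (classA (abs_chord_diagram (forget_framing d)))) \<longleftrightarrow>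
      (\<forall>D. D_M (?abs (basis_vector D)) = discolor D)" for D_M :: "'k framed_chord_space \<Rightarrow> 'k chord_space"
  proof (intro iffI allI impI)
    fix D
    assume *: "\<forall>d. framed_chords d \<longrightarrow> D_M (classM (abs_framed_chord_diagram d)) =
        scaleA ((- 1) ^ num_disorienting d) (classA (abs_chord_diagram (forget_framing d)))"
    obtain d where "framed_chords d" "D = abs_framed_chord_diagram d"
      by (rule abs_framed_chord_diagram_cases)
    then show "D_M (?abs (basis_vector D)) = discolor D"
      using * by (simp add: classM_def discolor_abs)
  qed (simp add: classM_def discolor_abs)
  show ?thesis
    unfolding determined
  proof (rule ex_ex1I, goal_cases)
    case 1
    \<comment> \<open>Linear extension starts from a function on the basis vectors themselves, hence
      the composition with \<open>inv basis_vector\<close>.\<close>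
    obtain g where g: "Vector_Spaces.linear free_scale scaleA g"
      and g_basis: "\<And>D. g (basis_vector D) = (discolor D :: 'k chord_space)"
      using FA.linear_independent_extend[OF independent_basis_vectors,
          of "discolor \<circ> inv basis_vector"]
      by (auto simp: inv_f_f[OF inj_basis_vector])
    interpret g: Vector_Spaces.linear free_scale scaleA g by (rule g)
    \<comment> \<open>Congruent elements differ by an element of the span of the relations, where
      \<open>g\<close> is zero; so \<open>g\<close> factors through the quotient.\<close>
    have g_cong: "g x = g y" if "congruent_mod framed_4T x y" for x y
      using FA.linear_eq_0_on_span[OF g vanishes_on_framed_4T[OF g g_basis]] that g.diff
      unfolding congruent_mod_def by (metis right_minus_eq)
    define D_M where "D_M m = g (rep_framed_chord_space m)" for m
    have D_M: "D_M (?abs x) = g x" for x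
      unfolding D_M_def
      by (rule g_cong, rule rep_abs_rsp_left[OF Quotient3_framed_chord_space congruent_mod_refl])
    have "Vector_Spaces.linear scaleM scaleA D_M"
    proof unfold_locales
      fix m n and a
      obtain x y where mn: "m = ?abs x" "n = ?abs y"
        using abs_rep by metis
      show "D_M (m + n) = D_M m + D_M n"
        by (simp add: mn plus_framed_chord_space.abs_eq D_M g.add)
      show "D_M (scaleM a m) = scaleA a (D_M m)"
        by (simp add: mn scaleM.abs_eq D_M g.scale)
    qed
    then show ?case using D_M g_basis by auto
  next
    case (2 D E)
    \<comment> \<open>Pulled back to the free space, both candidates are linear and agree on the
      spanning basis vectors; surjectivity of \<open>?abs\<close> then gives equality.\<close>
    have "D \<circ> ?abs = E \<circ> ?abs"
    proof
      fix x
      show "(D \<circ> ?abs) x = (E \<circ> ?abs) x"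
        by (rule FA.linear_eq_on_span[where B = "range basis_vector"])
          (auto simp: 2 span_basis_vectors simp del: o_apply
            intro!: Vector_Spaces.linear_compose[OF linear_abs_framed_chord_space], simp add: 2)
    qed
    then show ?case
      by (metis abs_rep comp_apply ext)
  qed
qed

end
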